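(* Let $G$ be a graph. Then $\mathcal{Z}(G;x)=\mathcal{P}(G;x)$ if and only if $G$ is isomorphic to a disjoint union $P_{a_1}\,\dot\cup\,\cdots\,\dot\cup\, P_{a_k}$ of paths with $a_i\le 2$ for all $1\le i\le k$.
   Context: Graphs are finite and simple with nonempty vertex set; $n$ is the number of vertices and $P_a$ is the path on $a$ vertices. For $S\subseteq V(G)$: $S$ is a power dominating set if, after coloring $S$, coloring every neighbor of a vertex of $S$ (domination step), and then repeatedly applying the forcing rule (a colored vertex with exactly one uncolored neighbor colors that neighbor) until no changes occur, all vertices are colored. $S$ is a zero forcing set if coloring $S$ and applying only the forcing rule repeatedly colors all vertices. $\mathcal{P}(G;x)=\sum_{i=1}^n p(G;i)x^i$ and $\mathcal{Z}(G;x)=\sum_{i=1}^n z(G;i)x^i$, where $p(G;i)$ and $z(G;i)$ are the numbers of power dominating sets and zero forcing sets of $G$ of size $i$. *)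

theory Defs
  imports
    "Graph_Theory.Pair_Digraph"
    "Graph_Theory.Digraph_Isomorphism"
    "HOL-Computational_Algebra.Polynomial"
begin

text \<open>
  A finite simple graph is a \<^locale>\<open>pair_graph\<close>: a finite vertex set with a symmetric
  irreflexive adjacency relation on it. That locale admits the null graph.
\<close>

definition neighbors :: "'a pair_pre_digraph \<Rightarrow> 'a \<Rightarrow> 'a set" where
  "neighbors G v = {w. (v, w) \<in> parcs G}"

inductive force :: "'a pair_pre_digraph \<Rightarrow> 'a set \<Rightarrow> 'a set \<Rightarrow> bool" for G where
  force: "v \<in> B \<Longrightarrow> neighbors G v - B = {w} \<Longrightarrow> force G B (insert w B)"

text \<open>
  The order of the forces is irrelevant: by the lemma \<open>forces_all_iff_final\<close> below, some sequence
  of forces colors all vertices iff every sequence that can no longer be extended does.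
\<close>

definition forces_all :: "'a pair_pre_digraph \<Rightarrow> 'a set \<Rightarrow> bool" where
  "forces_all G B \<longleftrightarrow> (force G)\<^sup>*\<^sup>* B (pverts G)"

definition zero_forcing_set :: "'a pair_pre_digraph \<Rightarrow> 'a set \<Rightarrow> bool" where
  "zero_forcing_set G S \<longleftrightarrow> S \<subseteq> pverts G \<and> forces_all G S"

definition power_dominating_set :: "'a pair_pre_digraph \<Rightarrow> 'a set \<Rightarrow> bool" where
  "power_dominating_set G S \<longleftrightarrow>
     S \<subseteq> pverts G \<and> forces_all G (S \<union> (\<Union>v\<in>S. neighbors G v))"

definition num_zero_forcing_sets :: "'a pair_pre_digraph \<Rightarrow> nat \<Rightarrow> nat" where
  "num_zero_forcing_sets G i = card {S. zero_forcing_set G S \<and> card S = i}"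

definition num_power_dominating_sets :: "'a pair_pre_digraph \<Rightarrow> nat \<Rightarrow> nat" where
  "num_power_dominating_sets G i = card {S. power_dominating_set G S \<and> card S = i}"

definition zero_forcing_poly :: "'a pair_pre_digraph \<Rightarrow> int poly" where
  "zero_forcing_poly G =
     (\<Sum>i = 1..card (pverts G). monom (int (num_zero_forcing_sets G i)) i)"

definition power_domination_poly :: "'a pair_pre_digraph \<Rightarrow> int poly" where
  "power_domination_poly G =
     (\<Sum>i = 1..card (pverts G). monom (int (num_power_dominating_sets G i)) i)"

definition path_graph :: "nat \<Rightarrow> nat pair_pre_digraph" where
  "path_graph a =
     \<lparr> pverts = {..<a},
       parcs = {(i, j). i < a \<and> j < a \<and> (j = Suc i \<or> i = Suc j)} \<rparr>"

definition disjoint_union ::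
    "'i set \<Rightarrow> ('i \<Rightarrow> 'a pair_pre_digraph) \<Rightarrow> ('i \<times> 'a) pair_pre_digraph" where
  "disjoint_union I H =
     \<lparr> pverts = (SIGMA i:I. pverts (H i)),
       parcs = {((i, u), (i, v)) | i u v. i \<in> I \<and> (u, v) \<in> parcs (H i)} \<rparr>"

lemma forces_subset_stuck:
  assumes "(force G)\<^sup>*\<^sup>* B C" "B \<subseteq> T" "\<nexists>T'. force G T T'"
  shows "C \<subseteq> T"
  using assms(1)
proof (induction rule: rtranclp_induct)
  case base
  show ?case by (rule assms(2))
next
  case (step C D)
  from step.hyps(2) obtain v w where vw: "v \<in> C" "neighbors G v - C = {w}" "D = insert w C"
    by (cases rule: force.cases) auto
  have "w \<in> T"
  proof (rule ccontr)
    assume "w \<notin> T"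
    then have "neighbors G v - T = {w}" using vw step.IH by auto
    then show False using vw step.IH assms(3) force.force[of v T G w] by blast
  qed
  then show ?case using vw step.IH by auto
qed

lemma force_increasing: "(force G)\<^sup>*\<^sup>* B C \<Longrightarrow> B \<subseteq> C"
proof (induction rule: rtranclp_induct)
  case (step C D)
  from step.hyps(2) have "C \<subseteq> D" by (cases rule: force.cases) auto
  with step.IH show ?case by blast
qed simp

lemma (in pair_graph) forces_all_iff_final:
  assumes "(force G)\<^sup>*\<^sup>* B C" "\<nexists>C'. force G C C'"
  shows "forces_all G B \<longleftrightarrow> C = pverts G"
proof
  assume "forces_all G B"
  then have BV: "(force G)\<^sup>*\<^sup>* B (pverts G)" by (simp add: forces_all_def)
  have stuck: "\<nexists>T'. force G (pverts G) T'"
  proof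
    assume "\<exists>T'. force G (pverts G) T'"
    then obtain v w where "neighbors G v - pverts G = {w}"
      by (metis force.simps)
    then show False
      using in_arcsD2 unfolding neighbors_def by blast
  qed
  have "pverts G \<subseteq> C"
    using forces_subset_stuck[OF BV force_increasing[OF assms(1)] assms(2)] .
  moreover have "C \<subseteq> pverts G"
    using forces_subset_stuck[OF assms(1) force_increasing[OF BV] stuck] .
  ultimately show "C = pverts G" by blast
next
  assume "C = pverts G"
  then show "forces_all G B" using assms(1) by (simp add: forces_all_def)
qed

lemma pair_graph_path_graph: "pair_graph (path_graph a)"
proof unfold_locales
  show "finite (parcs (path_graph a))"
    by (rule finite_subset[of _ "{..<a} \<times> {..<a}"]) (auto simp: path_graph_def)
qed (auto simp: path_graph_def symmetric_def sym_def)

lemma pair_graph_disjoint_union: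
  assumes "finite I" "\<And>i. i \<in> I \<Longrightarrow> pair_graph (H i)"
  shows "pair_graph (disjoint_union I H)"
proof -
  have *: "u \<in> pverts (H i)" "v \<in> pverts (H i)" "u \<noteq> v" "(v, u) \<in> parcs (H i)"
    if "i \<in> I" "(u, v) \<in> parcs (H i)" for i u v
  proof -
    interpret pair_graph "H i" using assms(2) that(1) .
    show "u \<in> pverts (H i)" "v \<in> pverts (H i)" "u \<noteq> v" "(v, u) \<in> parcs (H i)"
      using that(2) in_arcsD1 in_arcsD2 no_loops' arcs_symmetric by blast+
  qed
  have "finite (pverts (H i))" if "i \<in> I" for i
  proof -
    interpret pair_graph "H i" using assms(2) that .
    show ?thesis by (rule pair_finite_verts)
  qed
  then have fin: "finite (pverts (disjoint_union I H))"
    using assms(1) by (simp add: disjoint_union_def)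
  have wf: "parcs (disjoint_union I H)
      \<subseteq> pverts (disjoint_union I H) \<times> pverts (disjoint_union I H)"
    using * by (auto simp: disjoint_union_def)
  show ?thesis
  proof unfold_locales
    show "finite (parcs (disjoint_union I H))"
      using finite_subset[OF wf] fin by blast
    show "finite (pverts (disjoint_union I H))" by (rule fin)
  qed (use * in \<open>auto simp: disjoint_union_def symmetric_def sym_def\<close>)
qed

end

theory Submission
  imports Defs
begin

text \<open>
  Every zero forcing set is power dominating, so the polynomials agree iff every power dominating
  set is zero forcing. This is clear if all degrees are at most 1. Otherwise take a power dominating
  set \<open>S\<close> of least weight, where vertices of degree at least 2 count once and the others twice.
  A vertex of \<open>S\<close> with degree at least 2 and at most one neighbor outside \<open>S\<close> could be dropped:
  it is colored by one of its neighbors in \<open>S\<close> and then forces the remaining one. A leaf of \<open>S\<close>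
  with neighbor of degree at least 2 could be replaced by that neighbor. Hence, starting from \<open>S\<close>,
  forces happen only inside components with two vertices, and \<open>S\<close> is not zero forcing.
\<close>

section \<open>Forcing and stuck sets\<close>

text \<open>These are the sets closed under the forcing rule. They replace sequences of forces: the
  final coloring reached from a set is its least stuck superset.\<close>

definition stuck :: "'a pair_pre_digraph \<Rightarrow> 'a set \<Rightarrow> bool" where
  "stuck G T \<longleftrightarrow> (\<forall>v\<in>T. \<forall>w. neighbors G v - T \<noteq> {w})"

definition closed_nbhd :: "'a pair_pre_digraph \<Rightarrow> 'a set \<Rightarrow> 'a set" where
  "closed_nbhd G S = S \<union> (\<Union>v\<in>S. neighbors G v)"

lemma stuck_iff: "stuck G T \<longleftrightarrow> (\<nexists>T'. force G T T')"
  unfolding stuck_def force.simps by blast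

context pair_graph
begin

lemma neighbors_subset: "neighbors G v \<subseteq> pverts G"
  unfolding neighbors_def using in_arcsD2 by blast

lemma finite_neighbors: "finite (neighbors G v)"
  using neighbors_subset pair_finite_verts finite_subset by blast

lemma neighbors_sym: "u \<in> neighbors G v \<longleftrightarrow> v \<in> neighbors G u"
  unfolding neighbors_def using arcs_symmetric by blast

lemma not_self_neighbor: "v \<notin> neighbors G v"
  unfolding neighbors_def using no_loops' by blast

lemma neighbors_eq_singleton:
  assumes "card (neighbors G v) \<le> 1" "w \<in> neighbors G v"
  shows "neighbors G v = {w}"
  using assms by (auto simp: card_le_Suc0_iff_eq[OF finite_neighbors])

lemma closed_nbhd_subset: "S \<subseteq> pverts G \<Longrightarrow> closed_nbhd G S \<subseteq> pverts G"
  unfolding closed_nbhd_def using neighbors_subset by blast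

lemma obtain_stuck:
  assumes "B \<subseteq> pverts G"
  obtains C where "(force G)\<^sup>*\<^sup>* B C" "stuck G C"
proof -
  have "\<exists>C. (force G)\<^sup>*\<^sup>* B C \<and> stuck G C"
    using assms
  \<comment> \<open>Each force colors one more vertex, so the number of uncolored vertices bounds
    the length of the process.\<close>
  proof (induction "card (pverts G - B)" arbitrary: B rule: less_induct)
    case less
    show ?case
    proof (cases "stuck G B")
      case False
      then obtain v w where vw: "v \<in> B" "neighbors G v - B = {w}"
        unfolding stuck_def by blast
      then have w: "w \<in> pverts G - B" using neighbors_subset by blast
      then have "card (pverts G - insert w B) < card (pverts G - B)"
        using pair_finite_verts by (intro psubset_card_mono) auto
      with less w obtain C where C: "(force G)\<^sup>*\<^sup>* (insert w B) C" "stuck G C"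
        by (metis DiffD1 insert_subset)
      moreover have "force G B (insert w B)" by (rule force.force[OF vw])
      ultimately show ?thesis by (meson converse_rtranclp_into_rtranclp)
    qed blast
  qed
  then show ?thesis using that by blast
qed

lemma stuck_pverts: "stuck G (pverts G)"
  unfolding stuck_def using neighbors_subset by blast

text \<open>A force from a subset of a stuck set never leaves the stuck set, so a proper stuck
  superset of \<open>B\<close> blocks every sequence of forces. Conversely, running the forces to
  their end yields a stuck superset.\<close>

lemma forces_all_iff:
  assumes "B \<subseteq> pverts G"
  shows "forces_all G B \<longleftrightarrow> (\<forall>T. B \<subseteq> T \<and> T \<subseteq> pverts G \<and> stuck G T \<longrightarrow> T = pverts G)"
proof
  assume "forces_all G B"
  then show "\<forall>T. B \<subseteq> T \<and> T \<subseteq> pverts G \<and> stuck G T \<longrightarrow> T = pverts G"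
    unfolding forces_all_def stuck_iff by (meson forces_subset_stuck subset_antisym)
next
  assume *: "\<forall>T. B \<subseteq> T \<and> T \<subseteq> pverts G \<and> stuck G T \<longrightarrow> T = pverts G"
  obtain C where C: "(force G)\<^sup>*\<^sup>* B C" "stuck G C" using obtain_stuck[OF assms] .
  have "C \<subseteq> pverts G"
    using forces_subset_stuck[OF C(1) assms] stuck_pverts unfolding stuck_iff by blast
  with * C force_increasing[OF C(1)] have "C = pverts G" by blast
  with C(1) show "forces_all G B" by (simp add: forces_all_def)
qed

lemma power_dominating_set_iff:
  "power_dominating_set G S \<longleftrightarrow> S \<subseteq> pverts G \<and>
     (\<forall>T. closed_nbhd G S \<subseteq> T \<and> T \<subseteq> pverts G \<and> stuck G T \<longrightarrow> T = pverts G)"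
  unfolding power_dominating_set_def closed_nbhd_def[symmetric]
  by (rule conj_cong[OF refl]) (rule forces_all_iff[OF closed_nbhd_subset])

lemma zero_forcing_set_iff:
  "zero_forcing_set G S \<longleftrightarrow> S \<subseteq> pverts G \<and>
     (\<forall>T. S \<subseteq> T \<and> T \<subseteq> pverts G \<and> stuck G T \<longrightarrow> T = pverts G)"
  unfolding zero_forcing_set_def by (rule conj_cong[OF refl]) (rule forces_all_iff)

lemma zero_forcing_imp_power_dominating:
  "zero_forcing_set G S \<Longrightarrow> power_dominating_set G S"
  unfolding zero_forcing_set_iff power_dominating_set_iff closed_nbhd_def by simp

text \<open>The domination step is itself made of forces here: a vertex of \<open>S\<close> has at
  most one neighbor and can force it at once.\<close>

lemma power_dominating_imp_zero_forcing:
  assumes deg: "\<And>v. v \<in> pverts G \<Longrightarrow> card (neighbors G v) \<le> 1"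
    and S: "power_dominating_set G S"
  shows "zero_forcing_set G S"
proof -
  have "closed_nbhd G S \<subseteq> T" if T: "S \<subseteq> T" "T \<subseteq> pverts G" "stuck G T" for T
  proof -
    have "neighbors G v \<subseteq> T" if "v \<in> S" for v
    proof
      fix w assume w: "w \<in> neighbors G v"
      have "card (neighbors G v) \<le> 1" using deg that T by blast
      then have "neighbors G v = {w}"
        using w by (rule neighbors_eq_singleton)
      then show "w \<in> T" using T that unfolding stuck_def by blast
    qed
    then show ?thesis using T unfolding closed_nbhd_def by blast
  qed
  then show ?thesis using S unfolding zero_forcing_set_iff power_dominating_set_iff by blast
qed

section \<open>Minimum weight power dominating sets\<close>

text \<open>Serves both exchange steps below: \<open>S'\<close> inherits power domination from
  \<open>S\<close> as soon as \<open>S'\<close> eventually colors all that \<open>S\<close> colors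
  in its domination step.\<close>

lemma power_dominating_mono_closed_nbhd:
  assumes "power_dominating_set G S" "S' \<subseteq> pverts G"
    and "\<And>T. closed_nbhd G S' \<subseteq> T \<Longrightarrow> T \<subseteq> pverts G \<Longrightarrow> stuck G T \<Longrightarrow> closed_nbhd G S \<subseteq> T"
  shows "power_dominating_set G S'"
  unfolding power_dominating_set_iff
proof (intro conjI allI impI)
  fix T assume T: "closed_nbhd G S' \<subseteq> T \<and> T \<subseteq> pverts G \<and> stuck G T"
  then have "closed_nbhd G S \<subseteq> T" using assms(3) by simp
  with T assms(1) show "T = pverts G" unfolding power_dominating_set_iff by simp
qed (rule assms(2))

lemma power_dominating_remove:
  assumes S: "power_dominating_set G S" and s: "s \<in> S"
    and deg: "2 \<le> card (neighbors G s)" and out: "card (neighbors G s - S) \<le> 1"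
  shows "power_dominating_set G (S - {s})"
proof (rule power_dominating_mono_closed_nbhd[OF S])
  show "S - {s} \<subseteq> pverts G" using S unfolding power_dominating_set_iff by blast
  fix T assume T: "closed_nbhd G (S - {s}) \<subseteq> T" "stuck G T"
  \<comment> \<open>Of at least two neighbors at most one lies outside \<open>S\<close>, so some
    neighbor is in \<open>S\<close> and colors \<open>s\<close> after \<open>s\<close> is
    dropped.\<close>
  have "neighbors G s \<inter> S \<noteq> {}"
  proof
    assume "neighbors G s \<inter> S = {}"
    then have "neighbors G s - S = neighbors G s" by blast
    with deg out show False by simp
  qed
  then obtain t where t: "t \<in> neighbors G s" "t \<in> S" by blast
  then have "t \<in> S - {s}" "s \<in> neighbors G t"
    using not_self_neighbor neighbors_sym by auto
  then have sT: "s \<in> T" using T unfolding closed_nbhd_def by blast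
  have inS: "neighbors G s \<inter> S \<subseteq> T"
    using T not_self_neighbor unfolding closed_nbhd_def by blast
  have "neighbors G s \<subseteq> T"
  proof
    fix w assume w: "w \<in> neighbors G s"
    show "w \<in> T"
    proof (rule ccontr)
      assume wT: "w \<notin> T"
      \<comment> \<open>All neighbors of \<open>s\<close> in \<open>S\<close> are colored, so every
        uncolored one is among the at most one neighbor outside \<open>S\<close>.\<close>
      have "x = w" if "x \<in> neighbors G s - T" for x
      proof -
        have "x \<in> neighbors G s - S" "w \<in> neighbors G s - S" using that w wT inS by auto
        with out finite_neighbors[of s] show "x = w"
          by (metis One_nat_def card_le_Suc0_iff_eq finite_Diff)
      qed
      then have "neighbors G s - T = {w}" using w wT by blast
      then show False using T sT unfolding stuck_def by blast
    qed
  qed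
  then show "closed_nbhd G S \<subseteq> T" using T sT unfolding closed_nbhd_def by blast
qed

text \<open>The closed neighborhood of \<open>t\<close> contains \<open>s\<close> and
  \<open>t\<close>, which is the whole closed neighborhood of \<open>s\<close>.\<close>

lemma power_dominating_swap:
  assumes S: "power_dominating_set G S" and nbr: "neighbors G s = {t}"
  shows "power_dominating_set G (insert t (S - {s}))"
proof (rule power_dominating_mono_closed_nbhd[OF S])
  show "insert t (S - {s}) \<subseteq> pverts G"
    using S nbr neighbors_subset[of s] unfolding power_dominating_set_iff by blast
  fix T assume "closed_nbhd G (insert t (S - {s})) \<subseteq> T"
  moreover have "s \<in> neighbors G t" using nbr neighbors_sym by blast
  ultimately show "closed_nbhd G S \<subseteq> T" using nbr unfolding closed_nbhd_def by blast
qed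

text \<open>Cardinality alone need not drop when a leaf is traded for its neighbor. Charging 2 for
  low degrees makes both the removal and the trade for a vertex of degree at least 2 strict
  improvements.\<close>

definition weight :: "'a set \<Rightarrow> nat" where
  "weight S = (\<Sum>s\<in>S. if 2 \<le> card (neighbors G s) then 1 else 2)"

lemma obtain_min_power_dominating:
  obtains S where "power_dominating_set G S"
    and "\<And>s. s \<in> S \<Longrightarrow> 2 \<le> card (neighbors G s) \<Longrightarrow> 2 \<le> card (neighbors G s - S)"
    and "\<And>s t. s \<in> S \<Longrightarrow> neighbors G s = {t} \<Longrightarrow> card (neighbors G t) \<le> 1"
proof -
  have "power_dominating_set G (pverts G)"
    unfolding power_dominating_set_iff closed_nbhd_def by blast
  then obtain S where S: "power_dominating_set G S"
    and min: "\<And>S'. power_dominating_set G S' \<Longrightarrow> weight S \<le> weight S'"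
    using ex_has_least_nat[of "power_dominating_set G" _ weight] by blast
  have fin: "finite S"
    using S pair_finite_verts finite_subset unfolding power_dominating_set_iff by blast
  have rem: "weight S = weight (S - {s}) + (if 2 \<le> card (neighbors G s) then 1 else 2)"
    if "s \<in> S" for s
    unfolding weight_def by (subst sum.remove[OF fin that]) simp
  show ?thesis
  proof (rule that[OF S])
    fix s assume s: "s \<in> S" "2 \<le> card (neighbors G s)"
    show "2 \<le> card (neighbors G s - S)"
    proof (rule ccontr)
      assume "\<not> ?thesis"
      then have "power_dominating_set G (S - {s})"
        using power_dominating_remove[OF S s] by linarith
      from min[OF this] rem[OF s(1)] s(2) show False by simp
    qed
  next
    fix s t assume s: "s \<in> S" "neighbors G s = {t}"
    show "card (neighbors G t) \<le> 1"
    proof (rule ccontr)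
      assume "\<not> ?thesis"
      \<comment> \<open>The new vertex \<open>t\<close> has degree at least 2 and costs 1, or
        nothing if it was already present, whereas the leaf \<open>s\<close> saved 2.\<close>
      then have "weight (insert t (S - {s})) \<le> weight (S - {s}) + 1"
        using fin unfolding weight_def by (cases "t \<in> S - {s}") (auto simp: insert_absorb)
      with min[OF power_dominating_swap[OF S s(2)]] rem[OF s(1)] s(2) show False by simp
    qed
  qed
qed

lemma power_dominating_not_zero_forcing:
  assumes v: "v \<in> pverts G" "2 \<le> card (neighbors G v)"
  obtains S where "power_dominating_set G S" "\<not> zero_forcing_set G S"
proof -
  obtain S where S: "power_dominating_set G S"
    and big: "\<And>s. s \<in> S \<Longrightarrow> 2 \<le> card (neighbors G s) \<Longrightarrow> 2 \<le> card (neighbors G s - S)"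
    and leaf: "\<And>s t. s \<in> S \<Longrightarrow> neighbors G s = {t} \<Longrightarrow> card (neighbors G t) \<le> 1"
    by (rule obtain_min_power_dominating) blast
  \<comment> \<open>\<open>M\<close> collects what the degree-one vertices of \<open>S\<close> force
    at once. The set \<open>S \<union> M\<close> will be the stuck proper superset showing that
    \<open>S\<close> is not zero forcing.\<close>
  define M where "M = {t. \<exists>s\<in>S. neighbors G s = {t}}"
  \<comment> \<open>By \<open>leaf\<close>, the neighbor \<open>t\<close> has degree one too, so
    \<open>s\<close> and \<open>t\<close> form a component by themselves.\<close>
  have M: "neighbors G t = {s}" if "s \<in> S" "neighbors G s = {t}" for s t
  proof -
    have "s \<in> neighbors G t" using that neighbors_sym by blast
    with leaf[OF that] show ?thesis by (rule neighbors_eq_singleton)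
  qed
  \<comment> \<open>An element of \<open>M\<close> has a single neighbor, of degree one. Hence
    coloring \<open>M\<close> leaves the uncolored neighbors of high-degree vertices untouched,
    which gives \<open>out\<close>.\<close>
  have disj: "neighbors G s \<inter> M = {}" if s: "2 \<le> card (neighbors G s)" for s
  proof -
    have False if t: "t \<in> neighbors G s" "t \<in> M" for t
    proof -
      obtain s' where s': "s' \<in> S" "neighbors G s' = {t}" using t(2) unfolding M_def by blast
      have "s \<in> neighbors G t" using t(1) neighbors_sym by blast
      then have "s = s'" using M[OF s'] by blast
      with s' s show False by simp
    qed
    then show ?thesis by blast
  qed
  have out: "2 \<le> card (neighbors G s - (S \<union> M))" if "s \<in> S" "2 \<le> card (neighbors G s)" for s
  proof -
    have "neighbors G s - (S \<union> M) = neighbors G s - S" using disj[OF that(2)] by blast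
    then show ?thesis using big[OF that] by simp
  qed
  have "S \<union> M \<subseteq> pverts G"
    using S neighbors_subset unfolding power_dominating_set_iff M_def by blast
  moreover have "stuck G (S \<union> M)"
    unfolding stuck_def
  proof (intro ballI allI notI)
    fix x w assume x: "x \<in> S \<union> M" and w: "neighbors G x - (S \<union> M) = {w}"
    show False
    proof (cases "x \<in> S")
      case True
      \<comment> \<open>A larger degree would leave two neighbors outside by \<open>out\<close>. So
        \<open>w\<close> is the only neighbor of \<open>x\<close>, and then \<open>w\<close> already
        belongs to \<open>M\<close>.\<close>
      then have "card (neighbors G x) \<le> 1" using out[OF True] w by fastforce
      then have "neighbors G x = {w}"
        using w by (intro neighbors_eq_singleton) auto
      then show False using w True unfolding M_def by blast
    next
      case False
      then obtain s where s: "s \<in> S" "neighbors G s = {x}" using x unfolding M_def by blast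
      then have "neighbors G x - (S \<union> M) = {}" using M[OF s] by simp
      with w show False by simp
    qed
  qed
  moreover have "S \<union> M \<noteq> pverts G"
  proof
    assume eq: "S \<union> M = pverts G"
    show False
    \<comment> \<open>The high-degree vertex \<open>v\<close> rules out a full coloring: in
      \<open>S\<close> it would have uncolored neighbors by \<open>out\<close>, and in
      \<open>M\<close> it would have degree at most one.\<close>
    proof (cases "v \<in> S")
      case True
      have "neighbors G v - (S \<union> M) = {}" using neighbors_subset eq by blast
      with out[OF True v(2)] show False by simp
    next
      case False
      then obtain s where "s \<in> S" "neighbors G s = {v}" using v eq unfolding M_def by blast
      with leaf have "card (neighbors G v) \<le> 1" by blast
      with v(2) show False by simp
    qed
  qed
  ultimately have "\<not> zero_forcing_set G S" unfolding zero_forcing_set_iff by blast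
  with S that show ?thesis by blast
qed

section \<open>Comparing the polynomials\<close>

lemma finite_power_dominating_sets: "finite {S. power_dominating_set G S \<and> card S = i}"
  by (rule finite_subset[of _ "Pow (pverts G)"])
    (use pair_finite_verts in \<open>auto simp: power_dominating_set_def\<close>)

text \<open>Zero forcing sets are among the power dominating sets, so equal counts in each size
  leave no room for a difference between the two finite families.\<close>

lemma polys_eq_iff:
  assumes "pverts G \<noteq> {}"
  shows "zero_forcing_poly G = power_domination_poly G \<longleftrightarrow>
    (\<forall>S. power_dominating_set G S \<longrightarrow> zero_forcing_set G S)"
proof
  assume "\<forall>S. power_dominating_set G S \<longrightarrow> zero_forcing_set G S"
  then have "zero_forcing_set G = power_dominating_set G"
    using zero_forcing_imp_power_dominating by blast
  then show "zero_forcing_poly G = power_domination_poly G"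
    by (simp add: zero_forcing_poly_def power_domination_poly_def
        num_zero_forcing_sets_def num_power_dominating_sets_def)
next
  assume eq: "zero_forcing_poly G = power_domination_poly G"
  show "\<forall>S. power_dominating_set G S \<longrightarrow> zero_forcing_set G S"
  proof (intro allI impI)
    fix S assume S: "power_dominating_set G S"
    then have sub: "S \<subseteq> pverts G" by (simp add: power_dominating_set_def)
    \<comment> \<open>The empty set is stuck and is its own closed neighborhood. It has to be
      excluded because the sums start at exponent 1.\<close>
    have "S \<noteq> {}"
      using S assms unfolding power_dominating_set_iff closed_nbhd_def stuck_def by blast
    then have i: "card S \<in> {1..card (pverts G)}"
      using card_mono[OF pair_finite_verts sub] finite_subset[OF sub pair_finite_verts]
      by (auto simp: Suc_le_eq card_gt_0_iff)
    have "coeff (zero_forcing_poly G) (card S) = coeff (power_domination_poly G) (card S)"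
      using eq by simp
    then have "num_zero_forcing_sets G (card S) = num_power_dominating_sets G (card S)"
      using i by (simp add: zero_forcing_poly_def power_domination_poly_def coeff_sum)
    then have "{S'. zero_forcing_set G S' \<and> card S' = card S} =
        {S'. power_dominating_set G S' \<and> card S' = card S}"
      unfolding num_zero_forcing_sets_def num_power_dominating_sets_def
      using zero_forcing_imp_power_dominating
      by (intro card_subset_eq[OF finite_power_dominating_sets]) auto
    with S show "zero_forcing_set G S" by blast
  qed
qed

lemma polys_eq_iff_degree:
  assumes "pverts G \<noteq> {}"
  shows "zero_forcing_poly G = power_domination_poly G \<longleftrightarrow>
    (\<forall>v\<in>pverts G. card (neighbors G v) \<le> 1)"
proof
  assume "zero_forcing_poly G = power_domination_poly G"
  then have *: "\<forall>S. power_dominating_set G S \<longrightarrow> zero_forcing_set G S"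
    using polys_eq_iff[OF assms] by simp
  show "\<forall>v\<in>pverts G. card (neighbors G v) \<le> 1"
  proof (intro ballI leI notI)
    fix v assume "v \<in> pverts G" "1 < card (neighbors G v)"
    then obtain S where "power_dominating_set G S" "\<not> zero_forcing_set G S"
      using power_dominating_not_zero_forcing[of v] by auto
    with * show False by blast
  qed
next
  assume "\<forall>v\<in>pverts G. card (neighbors G v) \<le> 1"
  then show "zero_forcing_poly G = power_domination_poly G"
    using power_dominating_imp_zero_forcing unfolding polys_eq_iff[OF assms] by blast
qed

end

section \<open>Graphs of maximum degree at most 1\<close>

text \<open>Arcs of \<open>with_proj\<close> are pairs of vertices, so the vertex map dictates the
  arc map \<open>map_prod f f\<close>. The equivalence on arcs makes it onto
  \<open>parcs H\<close>.\<close>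

lemma digraph_iso_with_projI:
  assumes "pair_graph G" "pair_graph H" and f: "bij_betw f (pverts G) (pverts H)"
    and arcs: "\<And>u v. u \<in> pverts G \<Longrightarrow> v \<in> pverts G \<Longrightarrow>
      (u, v) \<in> parcs G \<longleftrightarrow> (f u, f v) \<in> parcs H"
  shows "digraph_iso (with_proj G) (with_proj H)"
proof -
  interpret G: pair_graph G by fact
  interpret H: pair_graph H by fact
  let ?h = "\<lparr>iso_verts = f, iso_arcs = map_prod f f, iso_head = snd, iso_tail = fst\<rparr>"
  have sub: "parcs G \<subseteq> pverts G \<times> pverts G" using G.in_arcsD1 G.in_arcsD2 by auto
  have inj: "inj_on f (pverts G)" and surj: "f ` pverts G = pverts H"
    using f by (auto simp: bij_betw_def)
  have "inj_on (map_prod f f) (parcs G)"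
    by (rule inj_on_subset[OF map_prod_inj_on[OF inj inj] sub])
  then have "pre_digraph.digraph_isomorphism (with_proj G) ?h"
    using inj G.wf_digraph_axioms by (auto simp: pre_digraph.digraph_isomorphism_def)
  moreover have "parcs H = map_prod f f ` parcs G"
  proof
    show "map_prod f f ` parcs G \<subseteq> parcs H" using arcs sub by fastforce
    show "parcs H \<subseteq> map_prod f f ` parcs G"
    proof
      fix e assume e: "e \<in> parcs H"
      obtain x y where xy: "e = (x, y)" by (cases e)
      then obtain u v where "u \<in> pverts G" "v \<in> pverts G" "x = f u" "y = f v"
        using e H.in_arcsD1 H.in_arcsD2 surj by blast
      with xy e arcs show "e \<in> map_prod f f ` parcs G" by force
    qed
  qed
  then have "with_proj H = app_iso ?h (with_proj G)"
    using surj by (simp add: app_iso_def with_proj_def)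
  ultimately show ?thesis unfolding digraph_iso_def by blast
qed

text \<open>Used to pull a degree bound back: distinct neighbors of a vertex go to distinct
  neighbors of its image.\<close>

lemma digraph_iso_with_projE:
  assumes "digraph_iso (with_proj G) (with_proj H)"
  obtains f where "inj_on f (pverts G)"
    and "\<And>u v. (u, v) \<in> parcs G \<Longrightarrow> (f u, f v) \<in> parcs H"
proof -
  from assms obtain h where h: "pre_digraph.digraph_isomorphism (with_proj G) h"
    and H: "with_proj H = app_iso h (with_proj G)"
    unfolding digraph_iso_def by blast
  have proj: "iso_tail h = fst" "iso_head h = snd" "parcs H = iso_arcs h ` parcs G"
    using H by (auto simp: app_iso_def with_proj_def)
  show ?thesis
  proof (rule that)
    show "inj_on (iso_verts h) (pverts G)"
      using h by (simp add: pre_digraph.digraph_isomorphism_def)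
    fix u v assume uv: "(u, v) \<in> parcs G"
    then have "iso_arcs h (u, v) = (iso_verts h u, iso_verts h v)"
      using h proj unfolding pre_digraph.digraph_isomorphism_def
      by (metis fst_conv prod.collapse snd_conv with_proj_simps(2,4,5))
    then show "(iso_verts h u, iso_verts h v) \<in> parcs H" using uv proj(3) by force
  qed
qed

text \<open>Paths on at most two vertices are complete, so any numbering of the vertices respects
  adjacency.\<close>

lemma parcs_path_graph_le_2:
  "a \<le> 2 \<Longrightarrow> (i, j) \<in> parcs (path_graph a) \<longleftrightarrow> i < a \<and> j < a \<and> i \<noteq> j"
  by (auto simp: path_graph_def)

lemma (in pair_graph) degree_le_1_iff_iso_paths:
  "(\<forall>v\<in>pverts G. card (neighbors G v) \<le> 1) \<longleftrightarrow>
    (\<exists>(k::nat) (a :: nat \<Rightarrow> nat).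
       (\<forall>i\<in>{1..k}. 1 \<le> a i \<and> a i \<le> 2) \<and>
       digraph_iso (with_proj G) (with_proj (disjoint_union {1..k} (\<lambda>i. path_graph (a i)))))"
  (is "?L \<longleftrightarrow> ?R")
proof
  assume ?R
  then obtain k a where a: "\<forall>i\<in>{1..k::nat}. 1 \<le> a i \<and> a i \<le> 2"
    and iso: "digraph_iso (with_proj G)
      (with_proj (disjoint_union {1..k} (\<lambda>i. path_graph (a i))))" by blast
  let ?H = "disjoint_union {1..k} (\<lambda>i. path_graph (a i))"
  obtain f where inj: "inj_on f (pverts G)"
    and f: "\<And>u v. (u, v) \<in> parcs G \<Longrightarrow> (f u, f v) \<in> parcs ?H"
    using digraph_iso_with_projE[OF iso] by blast
  \<comment> \<open>Both neighbors lie in the same path and differ from \<open>x\<close>, and a path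
    on at most two vertices has only one other vertex.\<close>
  have uniq: "y = z" if "(x, y) \<in> parcs ?H" "(x, z) \<in> parcs ?H" for x y z
  proof -
    from that obtain i p q r where "x = (i, p)" "y = (i, q)" "z = (i, r)" "i \<in> {1..k}"
      "(p, q) \<in> parcs (path_graph (a i))" "(p, r) \<in> parcs (path_graph (a i))"
      by (auto simp: disjoint_union_def)
    moreover from this a have "a i \<le> 2" by blast
    ultimately show "y = z" by (auto simp: parcs_path_graph_le_2)
  qed
  show ?L
  proof
    fix v assume "v \<in> pverts G"
    have "x = y" if "x \<in> neighbors G v" "y \<in> neighbors G v" for x y
    proof -
      have "f x = f y" using that f uniq unfolding neighbors_def by blast
      then show "x = y" using inj that neighbors_subset by (meson inj_onD subsetD)
    qed
    then show "card (neighbors G v) \<le> 1"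
      by (simp add: card_le_Suc0_iff_eq[OF finite_neighbors])
  qed
next
  assume deg: ?L
  \<comment> \<open>With degrees at most one, the closed neighborhood of \<open>v\<close> is its
    connected component, a single vertex or an edge.\<close>
  define C where "C v = insert v (neighbors G v)" for v
  have uniq: "x = y" if "x \<in> neighbors G v" "y \<in> neighbors G v" for x y v
  proof -
    have "v \<in> pverts G" using that(1) neighbors_sym neighbors_subset by blast
    with deg have "card (neighbors G v) \<le> Suc 0" by simp
    with that show ?thesis by (simp add: card_le_Suc0_iff_eq[OF finite_neighbors])
  qed
  have C_eq: "C u = C v" if "u \<in> C v" for u v
  proof (cases "u = v")
    case False
    then have "u \<in> neighbors G v" "v \<in> neighbors G u"
      using that neighbors_sym unfolding C_def by auto
    then have "neighbors G v = {u}" "neighbors G u = {v}" using uniq by blast+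
    then show ?thesis unfolding C_def by auto
  qed simp
  have C_card: "1 \<le> card (C v) \<and> card (C v) \<le> 2" if "v \<in> pverts G" for v
  proof -
    have "card (C v) = Suc (card (neighbors G v))"
      unfolding C_def using finite_neighbors not_self_neighbor by simp
    with deg that show ?thesis by auto
  qed
  have C_fin: "finite (C v)" for v unfolding C_def using finite_neighbors by simp
  have C_arc: "(u, v) \<in> parcs G \<longleftrightarrow> u \<noteq> v \<and> C u = C v" for u v
  proof
    assume uv: "(u, v) \<in> parcs G"
    then have "v \<in> C u" unfolding C_def neighbors_def by blast
    with C_eq uv no_loops' show "u \<noteq> v \<and> C u = C v" by blast
  next
    assume "u \<noteq> v \<and> C u = C v"
    then have uv: "u \<noteq> v" "C u = C v" by auto
    have "v \<in> C v" unfolding C_def by simp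
    with uv(2) have "v \<in> C u" by simp
    with uv(1) have "v \<in> neighbors G u" unfolding C_def by simp
    then show "(u, v) \<in> parcs G" unfolding neighbors_def by blast
  qed
  define K where "K = C ` pverts G"
  \<comment> \<open>The components are numbered from 1 to match the index set of the union;
    \<open>g'\<close> returns the number of a component.\<close>
  have "finite K" unfolding K_def using pair_finite_verts by simp
  then obtain g where g: "bij_betw g {1..card K} K"
    using ex_bij_betw_nat_finite_1 by blast
  define g' where "g' = the_inv_into {1..card K} g"
  have g': "bij_betw g' K {1..card K}" unfolding g'_def by (rule bij_betw_the_inv_into[OF g])
  have gg': "g (g' X) = X" if "X \<in> K" for X
    unfolding g'_def using f_the_inv_into_f_bij_betw[OF g] that by blast
  have g'g: "g' (g i) = i" if "i \<in> {1..card K}" for i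
    unfolding g'_def using g that the_inv_into_f_f by (metis bij_betw_def)
  define a where "a i = card (g i)" for i
  have gK: "g i \<in> K" if "i \<in> {1..card K}" for i using g that bij_betwE by blast
  have a: "\<forall>i\<in>{1..card K}. 1 \<le> a i \<and> a i \<le> 2"
    using gK C_card unfolding a_def K_def by fastforce
  \<comment> \<open>Inside each component the vertices are numbered from 0, as in
    \<open>path_graph\<close>. The isomorphism \<open>f\<close> pairs the component number with this
    position.\<close>
  have "\<forall>X\<in>K. \<exists>h. bij_betw h X {0..<card X}"
    using ex_bij_betw_finite_nat C_fin unfolding K_def by blast
  then obtain h where h: "\<And>X. X \<in> K \<Longrightarrow> bij_betw (h X) X {0..<card X}"
    by metis
  let ?H = "disjoint_union {1..card K} (\<lambda>i. path_graph (a i))"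
  define f where "f v = (g' (C v), h (C v) v)" for v
  have CK: "C v \<in> K" if "v \<in> pverts G" for v using that unfolding K_def by blast
  have g'K: "g' (C v) \<in> {1..card K}" if "v \<in> pverts G" for v
    using CK[OF that] g' bij_betwE by blast
  have ag': "a (g' (C v)) = card (C v)" if "v \<in> pverts G" for v
    unfolding a_def using gg' CK that by simp
  have hlt: "h (C v) v < card (C v)" if "v \<in> pverts G" for v
    using h[OF CK[OF that]] bij_betwE unfolding C_def by fastforce
  have f_eq: "f u = f v \<longleftrightarrow> u = v" if "u \<in> pverts G" "v \<in> pverts G" for u v
  proof
    assume eq: "f u = f v"
    then have Ceq: "C u = C v" using gg' CK that unfolding f_def by (metis prod.inject)
    moreover have "h (C u) u = h (C u) v" using eq Ceq unfolding f_def by simp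
    moreover have "u \<in> C u" "v \<in> C u" using Ceq unfolding C_def by auto
    ultimately show "u = v" using h[OF CK[OF that(1)]] by (meson bij_betw_def inj_onD)
  qed simp
  have "f ` pverts G = pverts ?H"
  proof
    show "f ` pverts G \<subseteq> pverts ?H"
      using g'K ag' hlt by (auto simp: f_def disjoint_union_def path_graph_def)
    show "pverts ?H \<subseteq> f ` pverts G"
    proof
      fix x assume "x \<in> pverts ?H"
      then obtain i p where x: "x = (i, p)" "i \<in> {1..card K}" "p < a i"
        by (auto simp: disjoint_union_def path_graph_def)
      then have "p \<in> h (g i) ` g i"
        using h[OF gK[OF x(2)]] unfolding a_def bij_betw_def by simp
      then obtain u where u: "u \<in> g i" "p = h (g i) u" by blast
      \<comment> \<open>\<open>v\<close> only represents the component numbered \<open>i\<close>;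
        the preimage of \<open>x\<close> is \<open>u\<close>, its vertex at position
        \<open>p\<close>.\<close>
      obtain v where v: "v \<in> pverts G" "g i = C v" using gK[OF x(2)] unfolding K_def by blast
      have "u \<in> pverts G" using u v neighbors_subset unfolding C_def by auto
      moreover have "C u = g i" using C_eq u v by simp
      then have "f u = x" unfolding f_def using g'g x u by simp
      ultimately show "x \<in> f ` pverts G" by blast
    qed
  qed
  then have bij: "bij_betw f (pverts G) (pverts ?H)"
    using f_eq by (simp add: bij_betw_def inj_on_def)
  have "digraph_iso (with_proj G) (with_proj ?H)"
  proof (rule digraph_iso_with_projI[OF _ _ bij])
    show "pair_graph G" by (rule pair_graph)
    show "pair_graph ?H" by (intro pair_graph_disjoint_union pair_graph_path_graph) simp
    fix u v assume uv: "u \<in> pverts G" "v \<in> pverts G"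
    have idx: "g' (C u) = g' (C v) \<longleftrightarrow> C u = C v" using gg' CK uv by metis
    have "(f u, f v) \<in> parcs ?H \<longleftrightarrow> g' (C u) = g' (C v) \<and>
        (h (C u) u, h (C v) v) \<in> parcs (path_graph (a (g' (C u))))"
      using g'K[OF uv(1)] by (auto simp: f_def disjoint_union_def)
    \<comment> \<open>Each component has at most two vertices, so adjacency in its path just says
      that the positions differ.\<close>
    also have "\<dots> \<longleftrightarrow> C u = C v \<and> h (C u) u \<noteq> h (C v) v"
      using idx ag' uv hlt C_card parcs_path_graph_le_2 by metis
    also have "\<dots> \<longleftrightarrow> C u = C v \<and> u \<noteq> v"
      using f_eq[OF uv] idx unfolding f_def by auto
    finally show "(u, v) \<in> parcs G \<longleftrightarrow> (f u, f v) \<in> parcs ?H" using C_arc by blast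
  qed
  with a show ?R by blast
qed

theorem theorem12:
  fixes G :: "'a pair_pre_digraph"
  assumes "pair_graph G" and "pverts G \<noteq> {}"
  shows "zero_forcing_poly G = power_domination_poly G \<longleftrightarrow>
    (\<exists>(k::nat) (a :: nat \<Rightarrow> nat).
       (\<forall>i\<in>{1..k}. 1 \<le> a i \<and> a i \<le> 2) \<and>
       digraph_iso (with_proj G) (with_proj (disjoint_union {1..k} (\<lambda>i. path_graph (a i)))))"
  using pair_graph.polys_eq_iff_degree[OF assms] pair_graph.degree_le_1_iff_iso_paths[OF assms(1)]
  by simp

end
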